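(* Let $n$ be a Vakil number with Vakil pair $(a,k)$, i.e. $\overline{n}=2^{a+1}k$ with integers $a\ge 0$, $k\ge 1$, $a\le k\le 2a+1$. Then $f(n)=k+\frac{a(a+1)}{2}$.
   Context: Consider the directed graph whose vertices are the non-negative integers, with an edge $n\to n-2^s$ ($s\ge 0$) whenever the $2^s$-bit in the binary expansion of $n$ is $0$ and $n-2^s\ge 0$. $f(n)$ denotes the length (number of edges) of the longest directed path starting at $n$. The binary class of a non-negative integer $n$ is the set of all non-negative integers $m$ whose binary representation agrees with that of $n$ after all trailing $1$'s have been removed from both; $\overline{n}$ denotes its minimal element, i.e. the number obtained from $n$ by deleting all trailing $1$'s ($\overline{n}=0$ if $n=2^t-1$). A non-negative integer $n$ is a Vakil number with Vakil pair $(a,k)$ if $\overline{n}=2^{a+1}k$ for integers $a\ge 0$, $k\ge 1$ with $a\le k\le 2a+1$. *)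

theory Defs
  imports "Graph_Theory.Pair_Digraph"
begin

definition bit_graph :: "nat pair_pre_digraph" where
  "bit_graph = \<lparr> pverts = UNIV, parcs = {(n, n - 2 ^ s) | n s. \<not> bit n s \<and> 2 ^ s \<le> n} \<rparr>"

(* Walks are arc lists, so length p is the number of edges. *)
definition path_lengths :: "nat \<Rightarrow> nat set" where
  "path_lengths n = {length p | p v. pre_digraph.apath (with_proj bit_graph) n p v}"

definition f :: "nat \<Rightarrow> nat" where
  "f n = Max (path_lengths n)"

(* Max is meaningful here: arcs strictly decrease, so path_lengths n is a
   non-empty subset of {..n}. *)
lemma length_apath_le:
  assumes "pre_digraph.apath (with_proj bit_graph) n p v"
  shows "length p \<le> n"
proof -
  have "set p \<subseteq> parcs bit_graph \<Longrightarrow> pcas n p v \<Longrightarrow> length p \<le> n"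
  proof (induction p arbitrary: n)
    case (Cons e es)
    then obtain s where "e = (n, n - 2 ^ s)" "2 ^ s \<le> n"
      by (auto simp: bit_graph_def)
    moreover have "(0::nat) < 2 ^ s" by simp
    ultimately show ?case using Cons.IH[of "n - 2 ^ s"] Cons.prems
      by (cases "(2::nat) ^ s") auto
  qed simp
  then show ?thesis
    using assms by (simp add: pre_digraph.apath_def pre_digraph.awalk_def cas_with_proj_eq)
qed

lemma finite_path_lengths: "finite (path_lengths n)"
  by (rule finite_subset[of _ "{..n}"]) (auto simp: path_lengths_def dest: length_apath_le)

lemma zero_in_path_lengths: "0 \<in> path_lengths n"
proof -
  have "pre_digraph.apath (with_proj bit_graph) n [] n"
    by (simp add: pre_digraph.apath_def pre_digraph.awalk_def cas_with_proj_eq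
        awalk_verts_with_proj_eq bit_graph_def)
  then show ?thesis
    unfolding path_lengths_def by force
qed

(* The string 1...1 becomes empty, which is read as 0. *)
function strip_ones :: "nat \<Rightarrow> nat" where
  "strip_ones n = (if odd n then strip_ones (n div 2) else n)"
  by auto
termination
  by (relation "measure id") (auto elim!: oddE)

declare strip_ones.simps [simp del]

definition binary_class :: "nat \<Rightarrow> nat set" where
  "binary_class n = {m. strip_ones m = strip_ones n}"

definition class_min :: "nat \<Rightarrow> nat" where
  "class_min n = (LEAST m. m \<in> binary_class n)"

lemma strip_ones_le: "strip_ones n \<le> n"
proof (induction n rule: strip_ones.induct)
  case (1 n)
  then show ?case
    by (subst strip_ones.simps) (auto intro: order_trans[OF _ div_le_dividend])
qed

lemma even_strip_ones: "even (strip_ones n)"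
proof (induction n rule: strip_ones.induct)
  case (1 n)
  then show ?case by (subst strip_ones.simps) auto
qed

lemma class_min_eq_strip_ones: "class_min n = strip_ones n"
  unfolding class_min_def
proof (rule Least_equality)
  show "strip_ones n \<in> binary_class n"
    using even_strip_ones[of n] by (simp add: binary_class_def strip_ones.simps[of "strip_ones n"])
  show "strip_ones n \<le> m" if "m \<in> binary_class n" for m
    using that strip_ones_le[of m] by (simp add: binary_class_def)
qed

definition vakil_pair :: "nat \<Rightarrow> nat \<Rightarrow> nat \<Rightarrow> bool" where
  "vakil_pair n a k \<longleftrightarrow> class_min n = 2 ^ (a + 1) * k \<and> 1 \<le> k \<and> a \<le> k \<and> k \<le> 2 * a + 1"

end

theory Submission
  imports Defs
begin

text \<open>
  Subtracting \<open>2 ^ s\<close> at a zero bit rewrites a block \<open>1 0\<dots>0\<close> ending at position \<open>s\<close> to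
  \<open>0 1\<dots>1\<close>, so trailing ones never matter. Upper bound: for every \<open>m\<close>, the quotient
  \<open>n div 2 ^ m\<close> plus the sum of \<open>m - 1 - p\<close> over the zero bits \<open>p < m\<close> strictly decreases
  along every arc. Lower bound: from \<open>c * 2 ^ (r + 1)\<close>, subtract \<open>2 ^ r\<close> and let the new one
  slide down to position \<open>0\<close>; these \<open>r + 1\<close> steps lead, up to a trailing one, to
  \<open>(c - 1) * 2 ^ r\<close>. Only when \<open>c = 2 * r + 2\<close> is \<open>2 ^ (r + 1)\<close> subtracted first instead.
\<close>

lemma wf_bit_graph: "wf_digraph (with_proj bit_graph)"
  by unfold_locales (auto simp: bit_graph_def)

lemma pawalk_verts_le:
  "set p \<subseteq> parcs bit_graph \<Longrightarrow> pcas n p v \<Longrightarrow> x \<in> set (pawalk_verts n p) \<Longrightarrow> x \<le> n"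
proof (induction p arbitrary: n)
  case (Cons e p)
  then have "snd e \<le> n" by (auto simp: bit_graph_def)
  moreover have "x = n \<or> x \<le> snd e" using Cons by auto
  ultimately show ?case by linarith
qed simp

text \<open>Arcs strictly decrease, so the distinctness of vertices demanded by \<open>apath\<close>
  is automatic. From here on only this recursion on the first arc is used, not arc lists.\<close>

lemma Suc_mem_path_lengths_iff:
  "Suc l \<in> path_lengths n \<longleftrightarrow> (\<exists>s. \<not> bit n s \<and> 2 ^ s \<le> n \<and> l \<in> path_lengths (n - 2 ^ s))"
proof -
  interpret wf_digraph "with_proj bit_graph" by (rule wf_bit_graph)
  have arc: "e \<in> parcs bit_graph \<and> fst e = n \<longleftrightarrow>
      (\<exists>s. e = (n, n - 2 ^ s) \<and> \<not> bit n s \<and> 2 ^ s \<le> n)" for e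
    by (auto simp: bit_graph_def)
  have fresh: "n \<notin> set (awalk_verts (n - 2 ^ s) p)"
    if "apath (n - 2 ^ s) p v" "2 ^ s \<le> n" for s p v
  proof
    assume "n \<in> set (awalk_verts (n - 2 ^ s) p)"
    with that have "n \<le> n - 2 ^ s"
      by (intro pawalk_verts_le)
        (auto simp: apath_def awalk_def cas_with_proj_eq awalk_verts_with_proj_eq)
    moreover have "(0::nat) < 2 ^ s" by simp
    ultimately show False using that(2) by linarith
  qed
  show ?thesis
  proof
    assume "Suc l \<in> path_lengths n"
    then obtain q v where "Suc l = length q" and q: "apath n q v"
      by (auto simp: path_lengths_def)
    then obtain e p where "q = e # p" "l = length p" by (cases q) auto
    with q have "e \<in> parcs bit_graph \<and> fst e = n" "apath (snd e) p v"
      by (simp_all add: apath_Cons_iff)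
    moreover from this arc[of e] obtain s where
      "e = (n, n - 2 ^ s)" "\<not> bit n s" "2 ^ s \<le> n"
      by blast
    ultimately show "\<exists>s. \<not> bit n s \<and> 2 ^ s \<le> n \<and> l \<in> path_lengths (n - 2 ^ s)"
      using \<open>l = length p\<close> by (auto simp: path_lengths_def)
  next
    assume "\<exists>s. \<not> bit n s \<and> 2 ^ s \<le> n \<and> l \<in> path_lengths (n - 2 ^ s)"
    then obtain s p v where s: "\<not> bit n s" "2 ^ s \<le> n"
      and p: "l = length p" "apath (n - 2 ^ s) p v"
      by (auto simp: path_lengths_def)
    then have "apath n ((n, n - 2 ^ s) # p) v"
      using arc[of "(n, n - 2 ^ s)"] fresh[of s p v] by (simp add: apath_Cons_iff) blast
    with p show "Suc l \<in> path_lengths n"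
      unfolding path_lengths_def by force
  qed
qed

lemma mem_path_lengths_step:
  assumes "l \<in> path_lengths (n - 2 ^ s)" "\<not> bit n s" "2 ^ s \<le> n"
  shows "Suc l \<in> path_lengths n"
  using assms by (auto simp: Suc_mem_path_lengths_iff)

text \<open>The final one is never cleared: arcs at bit \<open>Suc s\<close> of
  \<open>2 * x + 1\<close> mirror arcs at bit \<open>s\<close> of \<open>x\<close>, and their
  targets end in a one again.\<close>

lemma mem_path_lengths_double_Suc:
  "l \<in> path_lengths (2 * x + 1) \<longleftrightarrow> l \<in> path_lengths x"
proof (induction l arbitrary: x)
  case 0
  then show ?case by (simp add: zero_in_path_lengths)
next
  case (Suc l)
  have step: "(\<not> bit (2 * x + 1) (Suc s) \<and> 2 ^ Suc s \<le> 2 * x + 1 \<and>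
        l \<in> path_lengths (2 * x + 1 - 2 ^ Suc s)) \<longleftrightarrow>
      (\<not> bit x s \<and> 2 ^ s \<le> x \<and> l \<in> path_lengths (x - 2 ^ s))" for s
  proof (cases "2 ^ s \<le> x")
    case True
    then have "2 * x + 1 - 2 ^ Suc s = 2 * (x - 2 ^ s) + 1" by simp
    with True Suc.IH[of "x - 2 ^ s"] show ?thesis
      by (simp add: bit_Suc)
  next
    case False
    then show ?thesis by simp
  qed
  have "\<not> bit (2 * x + 1) s \<Longrightarrow> \<exists>s'. s = Suc s'" for s
    by (cases s) (simp_all add: bit_0)
  then show ?case
    unfolding Suc_mem_path_lengths_iff using step by metis
qed

lemma path_lengths_strip_ones: "path_lengths (strip_ones n) = path_lengths n"
proof (induction n rule: strip_ones.induct)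
  case (1 n)
  have "path_lengths (n div 2) = path_lengths n" if "odd n"
    using mem_path_lengths_double_Suc[of _ "n div 2"] that by auto
  with 1 show ?case
    by (subst strip_ones.simps) auto
qed

text \<open>
  Unrolled from the lowest bit, this is \<open>n div 2 ^ m\<close> plus the sum of \<open>m - 1 - p\<close> over the
  zero bits \<open>p < m\<close> of \<open>n\<close>.
\<close>

primrec weight :: "nat \<Rightarrow> nat \<Rightarrow> nat" where
  "weight 0 n = n"
| "weight (Suc m) n = weight m (n div 2) + (if even n then m else 0)"

text \<open>Controls the borrow: when an arc at bit 0 turns that bit into a one,
  \<open>weight (Suc m)\<close> loses the summand \<open>m\<close>, and the rest rises by less than
  \<open>m\<close>.\<close>

lemma weight_minus_one_less: "0 < n \<Longrightarrow> weight m (n - 1) < weight m n + m"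
proof (induction m arbitrary: n)
  case (Suc m)
  show ?case
  proof (cases "even n")
    case True
    with Suc.prems have "0 < n div 2" "(n - 1) div 2 = n div 2 - 1" "odd (n - 1)"
      by (auto elim!: evenE)
    with True Suc.IH[of "n div 2"] show ?thesis by simp
  next
    case False
    then have "(n - 1) div 2 = n div 2" by (auto elim!: oddE)
    with False show ?thesis by simp
  qed
qed simp

lemma weight_step_less:
  "\<not> bit n s \<Longrightarrow> 2 ^ s \<le> n \<Longrightarrow> weight m (n - 2 ^ s) < weight m n"
proof (induction m arbitrary: n s)
  case 0
  then have "0 < n" by (metis gr0I le_zero_eq power_not_zero zero_neq_numeral)
  then show ?case by simp
next
  case (Suc m)
  show ?case
  proof (cases s)
    case 0
    with Suc.prems have "even n" "0 < n div 2"
      by (auto simp: bit_0 elim!: evenE)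
    moreover from this have "(n - 1) div 2 = n div 2 - 1" "odd (n - 1)"
      by (auto elim!: evenE)
    ultimately show ?thesis
      using weight_minus_one_less[of "n div 2" m] 0 by simp
  next
    case (Suc s')
    with Suc.prems have "\<not> bit (n div 2) s'" "2 ^ s' \<le> n div 2"
      by (auto simp: bit_Suc)
    moreover have "(n - 2 ^ s) div 2 = n div 2 - 2 ^ s'" "even (n - 2 ^ s) \<longleftrightarrow> even n"
      using Suc Suc.prems by auto
    ultimately show ?thesis using Suc.IH[of "n div 2" s'] by simp
  qed
qed

lemma path_lengths_le_weight: "l \<in> path_lengths n \<Longrightarrow> l \<le> weight m n"
proof (induction l arbitrary: n)
  case (Suc l)
  then obtain s where "\<not> bit n s" "2 ^ s \<le> n" "l \<in> path_lengths (n - 2 ^ s)"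
    by (auto simp: Suc_mem_path_lengths_iff)
  with Suc.IH[of "n - 2 ^ s"] weight_step_less[of n s m] show ?case by simp
qed simp

text \<open>The \<open>m\<close> low zeros contribute 0 + 1 + ... + (m - 1); taking
  \<open>m = Suc a\<close> gives the upper bound.\<close>

lemma weight_power_mult: "weight m (2 ^ m * k) = k + m * (m - 1) div 2"
proof (induction m)
  case (Suc m)
  have "Suc m * m = m * (m - 1) + m * 2" by (cases m) simp_all
  then have "Suc m * m div 2 = m * (m - 1) div 2 + m" by simp
  with Suc show ?case by (simp add: mult.assoc)
qed simp

text \<open>Subtracting the next lower power moves the one at position \<open>r\<close> down by one
  place; divisibility of \<open>b\<close> keeps that place zero.\<close>

lemma mem_path_lengths_slide:
  "l \<in> path_lengths (b + 1) \<Longrightarrow> 2 ^ r dvd b \<Longrightarrow> l + r \<in> path_lengths (b + 2 ^ r)"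
proof (induction r)
  case (Suc r)
  then have "2 ^ r dvd b" by (auto elim: dvd_trans[rotated] simp: le_imp_power_dvd)
  with Suc have "l + r \<in> path_lengths (b + 2 ^ Suc r - 2 ^ r)" by (simp add: add.commute)
  moreover from Suc.prems(2) obtain q where "b = 2 ^ Suc r * q" by blast
  then have "b + 2 ^ Suc r = 2 ^ r * (2 * (q + 1))" by (simp add: algebra_simps)
  then have "\<not> bit (b + 2 ^ Suc r) r" by (simp add: bit_iff_odd)
  ultimately show ?case
    using mem_path_lengths_step[of "l + r" "b + 2 ^ Suc r" r] by simp
qed simp

lemma mem_path_lengths_descend:
  assumes "l \<in> path_lengths (c * 2 ^ Suc r)"
  shows "l + r + 2 \<in> path_lengths (Suc c * 2 ^ Suc (Suc r))"
proof -
  from assms have "l \<in> path_lengths (c * 2 ^ Suc (Suc r) + 1)"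
    using mem_path_lengths_double_Suc[of l "c * 2 ^ Suc r"] by (simp add: ac_simps)
  then have "l + Suc r \<in> path_lengths (c * 2 ^ Suc (Suc r) + 2 ^ Suc r)"
    by (rule mem_path_lengths_slide) (simp add: dvd_mult)
  moreover have "Suc c * 2 ^ Suc (Suc r) = 2 ^ Suc r * (2 * Suc c)" by simp
  then have "\<not> bit (Suc c * 2 ^ Suc (Suc r)) (Suc r)"
    by (simp only: bit_iff_odd) simp
  moreover have "Suc c * 2 ^ Suc (Suc r) - 2 ^ Suc r = c * 2 ^ Suc (Suc r) + 2 ^ Suc r"
    by simp
  ultimately show ?thesis
    using mem_path_lengths_step[of "l + Suc r" "Suc c * 2 ^ Suc (Suc r)" "Suc r"]
    by (simp del: power_Suc mult_Suc)
qed

text \<open>The range exceeds that of a Vakil pair by one for the induction: a descent lowers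
  \<open>c\<close> by one but the bound by two, so \<open>c = 2 * Suc r + 1\<close> lands on
  \<open>2 * r + 2\<close>.\<close>

lemma mem_path_lengths_power_mult:
  "r \<le> c \<Longrightarrow> c \<le> 2 * r + 2 \<Longrightarrow> c + r * (r + 1) div 2 \<in> path_lengths (c * 2 ^ Suc r)"
proof -
  have last: "2 * r + 2 + r * (r + 1) div 2 \<in> path_lengths ((2 * r + 2) * 2 ^ Suc r)"
    if "2 * r + 1 + r * (r + 1) div 2 \<in> path_lengths ((2 * r + 1) * 2 ^ Suc r)" for r
  proof -
    \<comment> \<open>The arc is legal because the factor \<open>2 * r + 2\<close> is even.\<close>
    have "(2 * r + 2) * 2 ^ Suc r = 2 ^ Suc r * (2 * (r + 1))" by simp
    then have "\<not> bit ((2 * r + 2) * 2 ^ Suc r) (Suc r)"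
      by (simp only: bit_iff_odd) simp
    moreover have "(2 * r + 2) * 2 ^ Suc r - 2 ^ Suc r = (2 * r + 1) * 2 ^ Suc r"
      by (simp add: algebra_simps)
    ultimately show ?thesis
      using mem_path_lengths_step[of _ "(2 * r + 2) * 2 ^ Suc r" "Suc r"] that by simp
  qed
  show "r \<le> c \<Longrightarrow> c \<le> 2 * r + 2 \<Longrightarrow> c + r * (r + 1) div 2 \<in> path_lengths (c * 2 ^ Suc r)"
  proof (induction r arbitrary: c)
    case 0
    have one: "1 \<in> path_lengths 2"
      using mem_path_lengths_step[of 0 2 0] by (simp add: zero_in_path_lengths bit_0)
    from 0 have "c = 0 \<or> c = 1 \<or> c = 2" by auto
    then show ?case
      using one last[of 0] by (elim disjE) (simp_all add: zero_in_path_lengths numeral_2_eq_2)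
  next
    case (Suc r)
    have main: "c + Suc r * (Suc r + 1) div 2 \<in> path_lengths (c * 2 ^ Suc (Suc r))"
      if "Suc r \<le> c" "c \<le> 2 * Suc r + 1" for c
    proof -
      obtain d where d: "c = Suc d" using \<open>Suc r \<le> c\<close> by (cases c) auto
      with that have "d + r * (r + 1) div 2 \<in> path_lengths (d * 2 ^ Suc r)"
        by (intro Suc.IH) simp_all
      then have "d + r * (r + 1) div 2 + r + 2 \<in> path_lengths (Suc d * 2 ^ Suc (Suc r))"
        by (rule mem_path_lengths_descend)
      \<comment> \<open>Of the \<open>r + 2\<close> arcs of the descent, one accounts for
        \<open>c = Suc d\<close> and \<open>r + 1\<close> for the growth of the triangular
        number.\<close>
      moreover have "Suc r * (Suc r + 1) = r * (r + 1) + (r + 1) * 2" by simp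
      then have "Suc r * (Suc r + 1) div 2 = r * (r + 1) div 2 + (r + 1)" by simp
      ultimately show ?thesis using d by (simp add: ac_simps)
    qed
    show ?case
    proof (cases "c = 2 * Suc r + 2")
      case True
      then show ?thesis using last[of "Suc r"] main[of "2 * Suc r + 1"] by simp
    next
      case False
      with Suc.prems show ?thesis by (intro main) simp_all
    qed
  qed
qed

theorem lemma1p2:
  fixes n a k :: nat
  assumes "vakil_pair n a k"
  shows "f n = k + a * (a + 1) div 2"
proof -
  from assms have n: "strip_ones n = 2 ^ Suc a * k" and k: "a \<le> k" "k \<le> 2 * a + 1"
    by (simp_all add: vakil_pair_def class_min_eq_strip_ones)
  have lengths: "path_lengths n = path_lengths (2 ^ Suc a * k)"
    using path_lengths_strip_ones[of n] n by simp
  show ?thesis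
    unfolding f_def
  proof (rule Max_eqI[OF finite_path_lengths])
    fix l assume "l \<in> path_lengths n"
    then show "l \<le> k + a * (a + 1) div 2"
      using path_lengths_le_weight[of l "2 ^ Suc a * k" "Suc a"] weight_power_mult[of "Suc a" k]
        lengths
      by (simp add: ac_simps)
  next
    show "k + a * (a + 1) div 2 \<in> path_lengths n"
      using mem_path_lengths_power_mult[of a k] k lengths by (simp add: ac_simps)
  qed
qed

end
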